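(* Let $n,r,N$ be positive integers and let $M\in\mathbb{S}^n_+$ with $\operatorname{rk}(M)=s\le r$. Let $\mathcal{A}:\mathbb{S}^n\to\mathbb{R}^N$ be linear, $b\in\mathbb{R}^N$, and $g_{\mathrm{sms}}:\mathbb{S}^n\to\mathbb{R}$, $g_{\mathrm{sms}}(A):=|\mathcal{A}(A)-b|^2$. Assume that $M$ is a global minimum of $g_{\mathrm{sms}}$. Moreover, suppose that $g_{\mathrm{sms}}$ satisfies the $\delta$-$\mathrm{RIP}_{s+r,s+r}$ condition for some $\delta>0$. Consider $f_1,f_{\mathrm{sms}}:\mathbb{R}^{n\times r}\to\mathbb{R}$ defined by $f_1(X):=\|XX^\top-M\|_1$ and $f_{\mathrm{sms}}(X):=g_{\mathrm{sms}}(XX^\top)$. Then $f_1$ has Kurdyka-Łojasiewicz exponent $1/2$ at any of its global minima, and $f_{\mathrm{sms}}$ has Kurdyka-Łojasiewicz exponent $3/4$ at any of its global minima.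
   Context: $\mathbb{S}^n$ is the space of real symmetric $n\times n$ matrices, $\mathbb{S}^n_+$ the set of positive semidefinite ones; $\|\cdot\|_1$ is the entrywise $\ell_1$ norm (sum of absolute values of entries), $\|\cdot\|_F$ the Frobenius norm and $|\cdot|$ the Euclidean norm. For $\delta>0$ and integers $w,t\ge 0$, a twice continuously differentiable $g:\mathbb{S}^n\to\mathbb{R}$ satisfies the $\delta$-$\mathrm{RIP}_{w,t}$ condition if $(1-\delta)\|H\|_F^2\le\nabla^2g(A)[H,H]\le(1+\delta)\|H\|_F^2$ for all $A,H\in\mathbb{S}^n$ with $\operatorname{rk}(A)\le w$ and $\operatorname{rk}(H)\le t$. Kurdyka-Łojasiewicz exponent: a locally Lipschitz function $f$ on a Euclidean space has Kurdyka-Łojasiewicz exponent $\alpha\in[0,1)$ at $\overline{x}$ if there exist $\rho,\ell,c>0$ such that $d(0,\overline\partial f(x))\ge c(f(x)-f(\overline{x}))^\alpha$ for all $x\in B_\rho(\overline{x})$ with $0<f(x)-f(\overline{x})<\ell$, where $\overline\partial f$ is the Clarke subdifferential (the convex hull of limits of gradients of $f$ at nearby points of differentiability) and $d(0,S)=\inf_{v\in S}|v|$.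
   Formalization: The formal statement requires 0 < δ < 1 in the RIP condition instead of merely δ > 0; for δ ≥ 1 the lower RIP bound is void and the claim about f_sms fails (e.g. n=3, r=1, M=e1e1^T, A(H)=(H13−H22, H23), b=0, δ=5). *)

theory Defs
  imports "HOL-Analysis.Analysis"
begin

text \<open>The norm and the inner product of \<^typ>\<open>real^'n^'m\<close> are the Frobenius ones.\<close>

definition symmat :: "(real^'n^'n) set" where
  "symmat = {A. transpose A = A}"

definition psdmat :: "(real^'n^'n) set" where
  "psdmat = {A \<in> symmat. \<forall>x. 0 \<le> x \<bullet> (A *v x)}"

definition l1_norm :: "real^'n^'m \<Rightarrow> real" where
  "l1_norm A = (\<Sum>i\<in>UNIV. \<Sum>j\<in>UNIV. \<bar>A $ i $ j\<bar>)"

text \<open>Functions on the space of symmetric matrices are represented by functions on all square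
  matrices; every notion below ignores the values outside \<^const>\<open>symmat\<close>.\<close>

definition linear_on_symmat :: "(real^'n^'n \<Rightarrow> 'b::real_vector) \<Rightarrow> bool" where
  "linear_on_symmat \<A> \<longleftrightarrow>
     (\<forall>A\<in>symmat. \<forall>B\<in>symmat. \<A> (A + B) = \<A> A + \<A> B) \<and>
     (\<forall>c. \<forall>A\<in>symmat. \<A> (c *\<^sub>R A) = c *\<^sub>R \<A> A)"

text \<open>\<open>g\<close> is twice continuously differentiable on the symmetric matrices, with first and second
  derivatives \<open>g'\<close> and \<open>g''\<close>. The derivatives are taken within \<^const>\<open>symmat\<close>, so they are uniquely
  determined exactly on symmetric directions.\<close>

definition C2_on_symmat ::
  "(real^'n^'n \<Rightarrow> real) \<Rightarrow> (real^'n^'n \<Rightarrow> (real^'n^'n) \<Rightarrow>\<^sub>L real) \<Rightarrow>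
   (real^'n^'n \<Rightarrow> (real^'n^'n) \<Rightarrow>\<^sub>L ((real^'n^'n) \<Rightarrow>\<^sub>L real)) \<Rightarrow> bool" where
  "C2_on_symmat g g' g'' \<longleftrightarrow>
     (\<forall>A\<in>symmat. (g has_derivative blinfun_apply (g' A)) (at A within symmat)) \<and>
     (\<forall>A\<in>symmat. (g' has_derivative blinfun_apply (g'' A)) (at A within symmat)) \<and>
     continuous_on symmat g''"

text \<open>Since \<open>g'' A H H\<close> is unique for symmetric \<open>A\<close> and \<open>H\<close>, the existential quantifiers only
  express that \<open>g\<close> is twice continuously differentiable. For \<open>\<delta> \<ge> 1\<close> the lower bound is void as soon
  as \<open>g\<close> is convex.\<close>

definition RIP :: "real \<Rightarrow> nat \<Rightarrow> nat \<Rightarrow> (real^'n^'n \<Rightarrow> real) \<Rightarrow> bool" where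
  "RIP \<delta> w t g \<longleftrightarrow> (\<exists>g' g''. C2_on_symmat g g' g'' \<and>
     (\<forall>A\<in>symmat. \<forall>H\<in>symmat. rank A \<le> w \<and> rank H \<le> t \<longrightarrow>
        (1 - \<delta>) * (norm H)\<^sup>2 \<le> g'' A H H \<and> g'' A H H \<le> (1 + \<delta>) * (norm H)\<^sup>2))"

definition locally_lipschitz :: "('a::euclidean_space \<Rightarrow> real) \<Rightarrow> bool" where
  "locally_lipschitz f \<longleftrightarrow> (\<forall>x. \<exists>\<rho>>0. \<exists>L. L-lipschitz_on (ball x \<rho>) f)"

definition clarke_subdifferential :: "('a::euclidean_space \<Rightarrow> real) \<Rightarrow> 'a \<Rightarrow> 'a set" where
  "clarke_subdifferential f x = convex hull
     {v. \<exists>y d. (\<forall>k::nat. GDERIV f (y k) :> d k) \<and> y \<longlonglongrightarrow> x \<and> d \<longlonglongrightarrow> v}"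

text \<open>The distance from the origin to the subdifferential is an infimum in \<^typ>\<open>ereal\<close>. (The
  subdifferential of a locally Lipschitz function is never empty, by Rademacher's theorem.)\<close>

definition has_KL_exponent :: "('a::euclidean_space \<Rightarrow> real) \<Rightarrow> real \<Rightarrow> 'a \<Rightarrow> bool" where
  "has_KL_exponent f \<alpha> xbar \<longleftrightarrow>
     locally_lipschitz f \<and> 0 \<le> \<alpha> \<and> \<alpha> < 1 \<and>
     (\<exists>\<rho>>0. \<exists>l>0. \<exists>c>0. \<forall>x\<in>ball xbar \<rho>. 0 < f x - f xbar \<and> f x - f xbar < l \<longrightarrow>
        ereal (c * (f x - f xbar) powr \<alpha>) \<le> (INF v\<in>clarke_subdifferential f x. ereal (norm v)))"

definition is_global_min_on :: "('a \<Rightarrow> real) \<Rightarrow> 'a set \<Rightarrow> 'a \<Rightarrow> bool" where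
  "is_global_min_on f S x \<longleftrightarrow> x \<in> S \<and> (\<forall>y\<in>S. f x \<le> f y)"

end

theory Submission
  imports Defs
begin

text \<open>
  Write \<open>E = X X\<^sup>T - M\<close>. Both objective functions have the form \<open>X \<mapsto> c + p(E)^k\<close> for a seminorm
  \<open>p\<close> on matrices: the \<open>\<ell>\<^sub>1\<close> norm with \<open>k = 1\<close> for \<open>f\<^sub>1\<close>, and the seminorm
  \<open>|\<A> \<cdot>|\<close> with \<open>k = 2\<close> for \<open>f\<^sub>s\<^sub>m\<^sub>s\<close>, because the residual \<open>\<A> M - b\<close> at the minimum \<open>M\<close> is
  orthogonal to the range of \<open>\<A>\<close> on symmetric matrices. In both cases \<open>p(E)\<close> is comparable to \<open>|E|\<close>; for
  \<open>\<A>\<close> this is the restricted isometry property, applicable since \<open>E\<close> has rank at most \<open>s + r\<close>. As \<open>M\<close> has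
  rank at most \<open>r\<close>, it factors as \<open>Y Y\<^sup>T\<close>, so the global minima are exactly the \<open>X\<close> with \<open>E = 0\<close>.
  It remains to show that \<open>c + p(E)^k\<close> has Kurdyka-Lojasiewicz exponent \<open>1 - 1/(2k)\<close> at such points
  (\<open>KL_exponent_seminorm_gram_power\<close>).

  The geometric core (\<open>descent_direction\<close>) is that near a solution of \<open>X X\<^sup>T = M\<close>, the linearized
  equation \<open>X V\<^sup>T + V X\<^sup>T = E\<close> has an approximate solution \<open>V\<close> with an error of order \<open>|E|\<^sup>2\<close> and with
  \<open>|V|\<close> of order \<open>|E|\<^sup>1\<^sup>/\<^sup>2\<close>. The square root is natural: the part of \<open>X\<close> outside the range of
  \<open>M\<close> may enter \<open>E\<close> only quadratically. Along \<open>- V\<close> the matrix \<open>E\<close>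
  shrinks to first order by the factor \<open>1 - t\<close>, up to a negligible error, so that, by convexity of \<open>p\<close>, every
  gradient \<open>d\<close> satisfies \<open>V \<bullet> d \<ge> (k/2) p(E)^k\<close>. Division by \<open>|V|\<close> leaves \<open>|d|\<close> at least of order
  \<open>p(E)^(k - 1/2)\<close>, which is \<open>(p(E)^k)^(1 - 1/(2k))\<close>. Since an inequality that is linear in \<open>d\<close> survives
  limits and convex combinations, the same bound holds on the whole Clarke subdifferential.
\<close>

section \<open>Frobenius norm and matrix products\<close>

lemma norm_squared_matrix: "(norm (A::real^'n^'m))\<^sup>2 = (\<Sum>i\<in>UNIV. \<Sum>j\<in>UNIV. (A $ i $ j)\<^sup>2)"
  by (simp add: norm_vec_def L2_set_def sum_nonneg)

lemma norm_transpose: "norm (transpose (A::real^'n^'m)) = norm A"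
proof -
  have "(norm (transpose A))\<^sup>2 = (norm A)\<^sup>2"
    unfolding norm_squared_matrix by (simp add: transpose_def) (rule sum.swap)
  thus ?thesis by (simp add: power2_eq_iff_nonneg)
qed

lemma norm_matrix_mult: "norm ((A::real^'n^'m) ** (B::real^'p^'n)) \<le> norm A * norm B"
proof -
  have "(norm (A ** B))\<^sup>2 = (\<Sum>i\<in>UNIV. \<Sum>j\<in>UNIV. ((A $ i) \<bullet> (transpose B $ j))\<^sup>2)"
    unfolding norm_squared_matrix
    by (simp add: matrix_matrix_mult_def inner_vec_def transpose_def)
  also have "\<dots> \<le> (\<Sum>i\<in>UNIV. \<Sum>j\<in>UNIV. (norm (A $ i))\<^sup>2 * (norm (transpose B $ j))\<^sup>2)"
    by (intro sum_mono) (simp only: power2_norm_eq_inner Cauchy_Schwarz_ineq)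
  also have "\<dots> = (norm A)\<^sup>2 * (norm (transpose B))\<^sup>2"
    using sum_product[of "\<lambda>i. (norm (A $ i))\<^sup>2" UNIV "\<lambda>j. (norm (transpose B $ j))\<^sup>2" UNIV]
    unfolding norm_vec_def[of A] norm_vec_def[of "transpose B"] L2_set_def
    by (simp only: real_sqrt_pow2 sum_nonneg zero_le_power2)
  finally have "(norm (A ** B))\<^sup>2 \<le> (norm A * norm B)\<^sup>2"
    by (simp add: norm_transpose power_mult_distrib)
  thus ?thesis by (rule power2_le_imp_le) simp
qed

lemma norm_matrix_vector_mult: "norm ((A::real^'n^'m) *v x) \<le> norm A * norm x"
proof -
  have "(norm (A *v x))\<^sup>2 = (\<Sum>i\<in>UNIV. ((A $ i) \<bullet> x)\<^sup>2)"
    by (simp add: norm_vec_def[of "A *v x"] L2_set_def sum_nonneg matrix_vector_mul_component)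
  also have "\<dots> \<le> (\<Sum>i\<in>UNIV. (norm (A $ i))\<^sup>2 * (norm x)\<^sup>2)"
    by (intro sum_mono) (simp only: power2_norm_eq_inner Cauchy_Schwarz_ineq)
  also have "\<dots> = (norm A * norm x)\<^sup>2"
    by (simp add: norm_vec_def[of A] L2_set_def sum_nonneg power_mult_distrib sum_distrib_right)
  finally show ?thesis by (rule power2_le_imp_le) simp
qed

lemma bounded_bilinear_matrix_mult:
  "bounded_bilinear ((**) :: real^'n^'m \<Rightarrow> real^'p^'n \<Rightarrow> real^'p^'m)"
proof
  fix A A' :: "real^'n^'m" and B B' :: "real^'p^'n" and r :: real
  show "(A + A') ** B = A ** B + A' ** B" by (simp add: vec_eq_iff matrix_matrix_mult_def algebra_simps sum.distrib)
  show "A ** (B + B') = A ** B + A ** B'" by (rule matrix_add_ldistrib)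
  show "(r *\<^sub>R A) ** B = r *\<^sub>R (A ** B)" by (simp add: scalar_matrix_assoc)
  show "A ** (r *\<^sub>R B) = r *\<^sub>R (A ** B)" by (simp add: matrix_scalar_ac scalar_matrix_assoc)
  show "\<exists>K. \<forall>(A::real^'n^'m) (B::real^'p^'n). norm (A ** B) \<le> norm A * norm B * K"
    using norm_matrix_mult by (metis mult.right_neutral)
qed

lemmas matrix_mult_linear_simps =
  bounded_bilinear.add_left[OF bounded_bilinear_matrix_mult]
  bounded_bilinear.add_right[OF bounded_bilinear_matrix_mult]
  bounded_bilinear.diff_left[OF bounded_bilinear_matrix_mult]
  bounded_bilinear.diff_right[OF bounded_bilinear_matrix_mult]
  bounded_bilinear.scaleR_left[OF bounded_bilinear_matrix_mult]
  bounded_bilinear.scaleR_right[OF bounded_bilinear_matrix_mult]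
  bounded_bilinear.zero_left[OF bounded_bilinear_matrix_mult]

lemma bounded_linear_transpose: "bounded_linear (transpose :: real^'n^'m \<Rightarrow> real^'m^'n)"
  by (rule bounded_linear_intro[where K = 1])
    (simp_all add: transpose_def vec_eq_iff norm_transpose[unfolded transpose_def])

lemmas transpose_linear_simps =
  bounded_linear.linear[OF bounded_linear_transpose, THEN linear_add]
  bounded_linear.linear[OF bounded_linear_transpose, THEN linear_diff]
  bounded_linear.linear[OF bounded_linear_transpose, THEN linear_scale]
  bounded_linear.linear[OF bounded_linear_transpose, THEN linear_0]

lemma norm_matrix_mult3: "norm ((A::real^'n^'m) ** (B::real^'p^'n) ** (C::real^'q^'p)) \<le> norm A * norm B * norm C"
  using norm_matrix_mult[of "A ** B" C] mult_right_mono[OF norm_matrix_mult[of A B], of "norm C"]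
  by simp

lemma norm_squared_le_gram:
  fixes X :: "real^'r^'n"
  shows "(norm X)\<^sup>2 \<le> CARD('n) * norm (X ** transpose X)"
proof -
  have "(norm X)\<^sup>2 = (\<Sum>i\<in>UNIV. (X ** transpose X) $ i $ i)"
    unfolding norm_squared_matrix
    by (simp add: matrix_matrix_mult_def transpose_def power2_eq_square)
  also have "\<dots> \<le> (\<Sum>i\<in>(UNIV::'n set). norm (X ** transpose X))"
  proof (rule sum_mono)
    fix i
    have "\<bar>(X ** transpose X) $ i $ i\<bar> \<le> norm ((X ** transpose X) $ i)"
      by (rule component_le_norm_cart)
    also have "\<dots> \<le> norm (X ** transpose X)"
      by (rule Finite_Cartesian_Product.norm_nth_le)
    finally show "(X ** transpose X) $ i $ i \<le> norm (X ** transpose X)" by simp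
  qed
  finally show ?thesis by simp
qed

section \<open>Bounded inverses and orthogonal projections\<close>

text \<open>
  An invertible \<open>J\<close> satisfies \<open>|J x| \<ge> \<mu> |x|\<close> for some \<open>\<mu> > 0\<close>, and a perturbation of norm at most \<open>\<mu>/2\<close>
  halves this constant at worst. The uniform bound on the inverse is what keeps the constants in
  \<open>descent_direction\<close> below independent of \<open>X\<close>.
\<close>

lemma bounded_inverse_near_invertible:
  fixes J :: "real^'n^'n"
  assumes J: "invertible J"
  shows "\<exists>\<epsilon>>0. \<exists>C\<ge>0. \<forall>F. norm F \<le> \<epsilon> \<longrightarrow> (\<exists>S. (J + F) ** S = mat 1 \<and> norm S \<le> C)"
proof -
  have "inj ((*v) J)"
    using J invertible_left_inverse matrix_left_invertible_injective by blast
  then obtain m where m: "m > 0" "\<And>x. m * norm x \<le> norm (J *v x)"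
    using linear_inj_bounded_below_pos[of "(*v) J"] by auto
  let ?C = "real CARD('n) * (real CARD('n) * (2 / m))"
  have "\<exists>S. (J + F) ** S = mat 1 \<and> norm S \<le> ?C" if F: "norm F \<le> m / 2" for F
  proof -
    have low: "m / 2 * norm x \<le> norm ((J + F) *v x)" for x
    proof -
      have "norm (F *v x) \<le> m / 2 * norm x"
        using norm_matrix_vector_mult[of F x] mult_right_mono[OF F norm_ge_zero[of x]] by linarith
      moreover have "norm (J *v x) \<le> norm ((J + F) *v x) + norm (F *v x)"
        using norm_triangle_ineq4[of "(J + F) *v x" "F *v x"] by (simp add: algebra_simps)
      ultimately show ?thesis using m(2)[of x] by linarith
    qed
    have "(J + F) *v x = 0 \<Longrightarrow> x = 0" for x
      using low[of x] m(1) by (simp add: mult_le_0_iff)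
    then obtain S where "S ** (J + F) = mat 1"
      using matrix_left_invertible_ker by blast
    then have S: "(J + F) ** S = mat 1" by (simp add: matrix_left_right_inverse)
    have ent: "\<bar>S $ i $ j\<bar> \<le> 2 / m" for i j
    proof -
      have "(J + F) *v (S *v axis j 1) = axis j 1"
        by (simp add: matrix_vector_mul_assoc S)
      then have "m / 2 * norm (S *v axis j 1) \<le> 1"
        using low[of "S *v axis j 1"] by simp
      then have "norm (S *v axis j 1) \<le> 2 / m"
        using m(1) by (simp add: field_simps)
      moreover have "\<bar>S $ i $ j\<bar> \<le> norm (S *v axis j 1)"
        using component_le_norm_cart[of "S *v axis j 1" i]
        by (simp add: matrix_vector_mult_basis column_def)
      ultimately show ?thesis by simp
    qed
    have "norm S \<le> (\<Sum>i\<in>UNIV. norm (S $ i))" 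
      unfolding norm_vec_def[of S] by (rule L2_set_le_sum) simp
    also have "\<dots> \<le> (\<Sum>i\<in>(UNIV::'n set). real CARD('n) * (2 / m))"
    proof (rule sum_mono)
      fix i
      have "norm (S $ i) \<le> (\<Sum>j\<in>UNIV. \<bar>S $ i $ j\<bar>)" by (rule norm_le_l1_cart)
      also have "\<dots> \<le> (\<Sum>j\<in>(UNIV::'n set). 2 / m)" by (intro sum_mono ent)
      finally show "norm (S $ i) \<le> real CARD('n) * (2 / m)" by simp
    qed
    finally show ?thesis using S by (metis (no_types) sum_constant)
  qed
  moreover have "?C \<ge> 0" using m(1) by simp
  moreover have "m / 2 > 0" using m(1) by simp
  ultimately show ?thesis by blast
qed

lemma orthogonal_projection_matrix:
  fixes U :: "(real^'n) set"
  assumes U: "subspace U"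
  shows "\<exists>P::real^'n^'n. transpose P = P \<and> (\<forall>x. P *v x \<in> U) \<and> (\<forall>x\<in>U. P *v x = x)"
proof -
  obtain B where B: "B \<subseteq> U" "pairwise orthogonal B" "\<And>x. x \<in> B \<Longrightarrow> norm x = 1"
    "independent B" "span B = U"
    using orthonormal_basis_subspace[OF U] by metis
  have fin: "finite B" using B(4) independent_imp_finite by blast
  define P :: "real^'n^'n" where "P = (\<chi> i j. \<Sum>b\<in>B. b $ i * b $ j)"
  have Pv: "P *v x = (\<Sum>b\<in>B. (b \<bullet> x) *\<^sub>R b)" for x
  proof (subst vec_eq_iff, rule allI)
    fix i
    have "(P *v x) $ i = (\<Sum>j\<in>UNIV. \<Sum>b\<in>B. b $ i * b $ j * x $ j)"
      by (simp add: P_def matrix_vector_mult_def sum_distrib_right)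
    also have "\<dots> = (\<Sum>b\<in>B. (\<Sum>j\<in>UNIV. b $ j * x $ j) * b $ i)"
      by (subst sum.swap) (simp only: sum_distrib_left sum_distrib_right ac_simps)
    finally show "(P *v x) $ i = (\<Sum>b\<in>B. (b \<bullet> x) *\<^sub>R b) $ i"
      by (simp add: inner_vec_def)
  qed
  have "transpose P = P" by (simp add: P_def transpose_def vec_eq_iff mult.commute)
  moreover have "P *v x \<in> U" for x
    unfolding Pv using B(1) U by (intro subspace_sum subspace_scale) auto
  moreover have "P *v x = x" if "x \<in> U" for x
  proof -
    have "x \<in> span B" using that B(5) by simp
    then show ?thesis
    proof (induction rule: span_induct)
      case base
      show ?case unfolding subspace_def
        by (simp add: matrix_vector_right_distrib matrix_vector_mult_scaleR)
    next
      case (step y)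
      have "P *v y = (\<Sum>b\<in>B. if b = y then y else 0)"
        unfolding Pv
        using step B(2,3) by (intro sum.cong refl) (auto simp: pairwise_def orthogonal_def norm_eq_1)
      then show ?case using fin step by simp
    qed
  qed
  ultimately show ?thesis by blast
qed

text \<open>
  The range and the kernel of a symmetric matrix \<open>M\<close> are orthogonal complements, so adding to \<open>M\<close> the
  projection onto its kernel makes it invertible. This replaces \<open>M\<close> by an invertible matrix that agrees
  with it on its range, and perturbations of a pseudoinverse by perturbations of an inverse.
\<close>

lemma symmetric_range_projection:
  fixes M :: "real^'n^'n"
  assumes M: "transpose M = M"
  shows "\<exists>P. transpose P = P \<and> P ** P = P \<and> P ** M = M \<and> invertible (M + (mat 1 - P))"
proof -
  obtain P :: "real^'n^'n" where P: "transpose P = P"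
    "\<And>x. P *v x \<in> range ((*v) M)" "\<And>x. x \<in> range ((*v) M) \<Longrightarrow> P *v x = x"
    using orthogonal_projection_matrix[of "range ((*v) M)"]
    by (metis linear_subspace_image matrix_vector_mul_linear subspace_UNIV)
  have PP: "P ** P = P"
    by (subst matrix_eq) (simp add: matrix_vector_mul_assoc[symmetric] P)
  have PM: "P ** M = M"
    by (subst matrix_eq) (simp add: matrix_vector_mul_assoc[symmetric] P)
  have MP: "M ** P = M" using PM P(1) M by (metis matrix_transpose_mul)
  have "x = 0" if "(M + (mat 1 - P)) *v x = 0" for x
  proof -
    have eq: "M *v x + (x - P *v x) = 0" using that by (simp add: algebra_simps)
    have "P *v (M *v x + (x - P *v x)) = M *v x"
      by (simp add: algebra_simps matrix_vector_mul_assoc PP PM)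
    then have Mx: "M *v x = 0" using eq by simp
    then have Px: "P *v x = x" using eq by simp
    then obtain y where y: "x = M *v y" using P(2)[of x] by auto
    have "x \<bullet> x = y \<bullet> (M *v x)"
      by (metis M y dot_lmul_matrix inner_commute transpose_matrix_vector)
    then show ?thesis using Mx by simp
  qed
  then have "invertible (M + (mat 1 - P))"
    using invertible_left_inverse matrix_left_invertible_ker by blast
  with P(1) PP PM show ?thesis by blast
qed

section \<open>Approximate solution of the linearized factorization equation\<close>

text \<open>
  The matrix \<open>S\<close> inverts the compression of \<open>A = M + E\<close> to the range of the projection \<open>P\<close>. Symmetry of
  \<open>S\<close> follows on evaluating \<open>S\<^sup>T A S\<close> in two ways.
\<close>

lemma perturbed_pseudoinverse:
  fixes M P S E :: "real^'n^'n"
  assumes sym: "transpose M = M" "transpose P = P" "transpose E = E"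
    and P: "P ** P = P" "P ** M = M"
    and S: "P ** (M + E) ** S = P" "P ** S = S"
  shows "transpose S = S" "S ** (M + E) = P + S ** E ** (mat 1 - P)"
proof -
  let ?A = "M + E" and ?Q = "mat 1 - P"
  have symA: "transpose ?A = ?A" by (simp add: transpose_linear_simps sym)
  have "transpose S ** ?A ** S = transpose S"
    using S sym by (metis matrix_mul_assoc matrix_transpose_mul)
  moreover have "transpose (transpose S ** ?A ** S) = transpose S ** ?A ** S"
    by (simp add: matrix_transpose_mul symA matrix_mul_assoc)
  ultimately show symS: "transpose S = S" by (metis transpose_transpose)
  have "?Q ** ?A = ?Q ** E"
    by (simp add: matrix_mult_linear_simps P)
  then have Q: "?Q ** ?A ** S = ?Q ** E ** S" by simp
  have "?A ** S = P ** ?A ** S + ?Q ** ?A ** S"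
    by (simp add: matrix_mult_linear_simps)
  then have AS: "?A ** S = P + ?Q ** E ** S" unfolding S Q .
  have "transpose (?A ** S) = transpose (P + ?Q ** E ** S)" unfolding AS ..
  then show "S ** ?A = P + S ** E ** ?Q"
    by (simp only: matrix_transpose_mul transpose_linear_simps sym symS symA transpose_mat matrix_mul_assoc)
qed

text \<open>
  The equation \<open>X V\<^sup>T + V X\<^sup>T = E\<close> is solved up to second order by \<open>V = L X\<close>, in which case \<open>V X\<^sup>T = L A\<close>
  with \<open>A = X X\<^sup>T = M + E\<close>. The choice of \<open>L\<close> arises as follows. With \<open>V = X/2\<close> the left-hand side is \<open>A\<close>.
  Subtracting \<open>M S X / 2\<close> removes \<open>M\<close>, since \<open>S A\<close> is \<open>P\<close> up to order \<open>E\<close>, but leaves errors of first order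
  in the block \<open>Q E P\<close> between the range of \<open>M\<close> and its complement. The term \<open>Q E S M S X / 2\<close> cancels
  these and leaves only a second-order error. Finally \<open>1 - M S = Q + P E S\<close> gives the form of \<open>L\<close> used here,
  which shows that \<open>L\<close> equals \<open>Q/2\<close> up to order \<open>E\<close>.
\<close>

lemma approximate_lyapunov_factor:
  fixes M P S E :: "real^'n^'n"
  assumes sym: "transpose M = M" "transpose P = P" "transpose E = E"
    and P: "P ** P = P" "P ** M = M"
    and S: "P ** (M + E) ** S = P" "P ** S = S"
  defines "Q \<equiv> mat 1 - P"
  defines "L \<equiv> (1/2) *\<^sub>R (Q + P ** E ** S + Q ** E ** S ** M ** S)"
  shows "L ** (M + E) + transpose (L ** (M + E)) = E + Q ** E ** S ** M ** S ** E ** Q"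
proof -
  let ?A = "M + E"
  note inv = perturbed_pseudoinverse[OF sym P S, folded Q_def]
  have symQ: "transpose Q = Q" by (simp add: Q_def transpose_linear_simps sym)
  have MP: "M ** P = M" using P sym by (metis matrix_transpose_mul)
  have "P ** ?A ** S = M ** S + P ** E ** S"
    by (simp add: matrix_mult_linear_simps P)
  then have "M ** S = P - P ** E ** S" using S by (simp add: algebra_simps)
  then have L: "L = (1/2) *\<^sub>R (mat 1 - M ** S + Q ** E ** S ** M ** S)"
    by (simp add: L_def Q_def)
  have MSA: "M ** S ** ?A = M + M ** S ** E ** Q"
    using inv(2) by (metis MP matrix_add_ldistrib matrix_mul_assoc)
  have "Q ** E ** S ** M ** S ** ?A = Q ** E ** S ** (M ** S ** ?A)"
    by (simp only: matrix_mul_assoc)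
  then have QMSA: "Q ** E ** S ** M ** S ** ?A = Q ** E ** S ** M + Q ** E ** S ** M ** S ** E ** Q"
    unfolding MSA by (simp only: matrix_add_ldistrib matrix_mul_assoc)
  have LA: "L ** ?A = (1/2) *\<^sub>R (E - M ** S ** E ** Q + Q ** E ** S ** M + Q ** E ** S ** M ** S ** E ** Q)"
  proof -
    have "L ** ?A = (1/2) *\<^sub>R (?A - M ** S ** ?A + Q ** E ** S ** M ** S ** ?A)"
      unfolding L by (simp only: matrix_mult_linear_simps(1,3,5) matrix_mul_lid)
    then show ?thesis unfolding MSA QMSA by simp
  qed
  have t1: "transpose (M ** S ** E ** Q) = Q ** E ** S ** M"
    by (simp add: matrix_transpose_mul sym inv(1) symQ matrix_mul_assoc)
  have t2: "transpose (Q ** E ** S ** M) = M ** S ** E ** Q"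
    by (simp add: matrix_transpose_mul sym inv(1) symQ matrix_mul_assoc)
  have t3: "transpose (Q ** E ** S ** M ** S ** E ** Q) = Q ** E ** S ** M ** S ** E ** Q"
    by (simp add: matrix_transpose_mul sym inv(1) symQ matrix_mul_assoc)
  have half: "(1/2) *\<^sub>R (E - a + b + c) + (1/2) *\<^sub>R (E - b + a + c) = E + c" for a b c :: "real^'n^'n"
  proof -
    have "(E - a + b + c) + (E - b + a + c) = 2 *\<^sub>R (E + c)" by (simp add: scaleR_2)
    then show ?thesis by (simp flip: scaleR_add_right)
  qed
  show ?thesis unfolding LA
    by (simp only: transpose_linear_simps t1 t2 t3 sym half)
qed

text \<open>
  In \<open>V = L X\<close> all terms are of order \<open>E\<close> except \<open>Q X / 2\<close>, the part of \<open>X\<close> outside the range of \<open>M\<close>. Its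
  size is controlled by \<open>(Q X)(Q X)\<^sup>T = Q E Q\<close>, hence is of order \<open>|E|\<^sup>1\<^sup>/\<^sup>2\<close>.
\<close>

lemma descent_direction:
  fixes M :: "real^'n^'n" and B :: real
  assumes M: "transpose M = M"
  shows "\<exists>\<epsilon>>0. \<exists>C. \<forall>X::real^'r^'n. norm X \<le> B \<and> norm (X ** transpose X - M) \<le> \<epsilon> \<longrightarrow>
    (\<exists>V. norm V \<le> C * sqrt (norm (X ** transpose X - M)) \<and>
      norm (X ** transpose V + V ** transpose X - (X ** transpose X - M))
        \<le> C * (norm (X ** transpose X - M))\<^sup>2)"
proof -
  obtain P where P: "transpose P = P" "P ** P = P" "P ** M = M"
    and J: "invertible (M + (mat 1 - P))"
    using symmetric_range_projection[OF M] by blast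
  define Q where "Q = mat 1 - P"
  obtain \<epsilon> C0 where \<epsilon>: "\<epsilon> > 0" and C0: "C0 \<ge> 0"
    and inv: "\<And>F. norm F \<le> \<epsilon> \<Longrightarrow> \<exists>S. (M + Q + F) ** S = mat 1 \<and> norm S \<le> C0"
    using bounded_inverse_near_invertible[OF J] unfolding Q_def by blast
  define p where "p = norm P + 1"
  have p: "p > 0" "norm P \<le> p" by (auto simp: p_def add_pos_nonneg add_nonneg_pos)
  \<comment> \<open>The bound \<open>1\<close> makes \<open>|E| \<le> |E|\<^sup>1\<^sup>/\<^sup>2\<close>; the other one makes \<open>|P E P| \<le> \<epsilon>\<close>.\<close>
  define \<epsilon>' where "\<epsilon>' = min 1 (\<epsilon> / p\<^sup>2)"
  define \<sigma> where "\<sigma> = norm P * C0"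
  define q where "q = norm Q"
  define C1 where "C1 = q * sqrt CARD('n) + (norm P * \<sigma> + q * \<sigma> * norm M * \<sigma>) * B"
  define C2 where "C2 = q * \<sigma> * norm M * \<sigma> * q"
  have \<sigma>: "\<sigma> \<ge> 0" by (simp add: \<sigma>_def C0)
  have "\<exists>V. norm V \<le> max C1 C2 * sqrt (norm (X ** transpose X - M)) \<and>
      norm (X ** transpose V + V ** transpose X - (X ** transpose X - M))
        \<le> max C1 C2 * (norm (X ** transpose X - M))\<^sup>2"
    if X: "norm X \<le> B" and small: "norm (X ** transpose X - M) \<le> \<epsilon>'" for X :: "real^'r^'n"
  proof -
    define E where "E = X ** transpose X - M"
    have A: "X ** transpose X = M + E" by (simp add: E_def)
    have symE: "transpose E = E"
      by (simp add: E_def transpose_linear_simps matrix_transpose_mul M)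
    have E: "norm E \<le> 1" "norm E \<le> \<epsilon> / p\<^sup>2" using small by (auto simp: E_def \<epsilon>'_def)
    have "norm (P ** E ** P) \<le> p * norm E * p"
      by (rule order_trans[OF norm_matrix_mult3]) (use p in \<open>intro mult_mono; simp\<close>)
    also have "\<dots> \<le> \<epsilon>" using E(2) p(1) by (simp add: field_simps power2_eq_square)
    finally obtain S0 where S0: "(M + Q + P ** E ** P) ** S0 = mat 1" "norm S0 \<le> C0"
      using inv by blast
    define S where "S = P ** S0"
    have "P ** (M + Q + P ** E ** P) = P ** (M + E) ** P"
      using P M
      by (simp add: Q_def matrix_mult_linear_simps matrix_mul_assoc) (metis matrix_transpose_mul)
    then have "P ** (M + E) ** P ** S0 = P"
      using S0(1) by (metis matrix_mul_assoc matrix_mul_rid)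
    then have S: "P ** (M + E) ** S = P" "P ** S = S"
      using P by (simp_all add: S_def matrix_mul_assoc)
    have nS: "norm S \<le> \<sigma>"
      unfolding S_def \<sigma>_def
      by (rule order_trans[OF norm_matrix_mult mult_left_mono[OF S0(2)]]) simp
    have nQ: "norm Q = q" by (simp add: q_def)
    define L where "L = (1/2) *\<^sub>R (Q + P ** E ** S + Q ** E ** S ** M ** S)"
    define V where "V = L ** X"
    have VX: "V ** transpose X = L ** (M + E)"
      by (simp add: V_def A flip: matrix_mul_assoc)
    have XV: "X ** transpose V = transpose (L ** (M + E))"
      by (simp add: VX[symmetric] matrix_transpose_mul)
    have res: "X ** transpose V + V ** transpose X - E = Q ** E ** S ** M ** S ** E ** Q"
      using approximate_lyapunov_factor[OF M P(1) symE P(2,3) S]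
      unfolding XV VX L_def Q_def by (simp add: algebra_simps)
    have nQES: "norm (Q ** E ** S) \<le> q * norm E * \<sigma>"
      by (rule order_trans[OF norm_matrix_mult3]) (intro mult_mono nS; simp add: q_def)
    have nSEQ: "norm (S ** E ** Q) \<le> \<sigma> * norm E * q"
      by (rule order_trans[OF norm_matrix_mult3]) (intro mult_mono nS; simp add: q_def \<sigma>)
    have nPES: "norm (P ** E ** S) \<le> norm P * norm E * \<sigma>"
      by (rule order_trans[OF norm_matrix_mult3]) (intro mult_mono nS; simp)
    have nQESMS: "norm (Q ** E ** S ** M ** S) \<le> (q * norm E * \<sigma>) * norm M * \<sigma>"
      by (rule order_trans[OF norm_matrix_mult3]) (intro mult_mono nS nQES; simp add: q_def \<sigma>)
    have "norm ((Q ** E ** S) ** M ** (S ** E ** Q)) \<le> (q * norm E * \<sigma>) * norm M * (\<sigma> * norm E * q)"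
      by (rule order_trans[OF norm_matrix_mult3]) (intro mult_mono nSEQ nQES; simp add: q_def \<sigma>)
    then have nres: "norm (X ** transpose V + V ** transpose X - E) \<le> C2 * (norm E)\<^sup>2"
      unfolding res C2_def by (simp add: matrix_mul_assoc power2_eq_square algebra_simps)
    have QM: "Q ** M = 0" by (simp add: Q_def matrix_mult_linear_simps P)
    have "(Q ** X) ** transpose (Q ** X) = Q ** (M + E) ** transpose Q"
      by (simp add: matrix_transpose_mul A[symmetric] matrix_mul_assoc)
    also have "\<dots> = Q ** E ** transpose Q"
      by (simp add: matrix_mult_linear_simps QM)
    finally have "norm ((Q ** X) ** transpose (Q ** X)) \<le> q * norm E * q"
      using norm_matrix_mult3[of Q E "transpose Q"] by (simp add: q_def norm_transpose)
    then have "(norm (Q ** X))\<^sup>2 \<le> CARD('n) * (q * norm E * q)"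
      using norm_squared_le_gram[of "Q ** X"] mult_left_mono
      by (meson of_nat_0_le_iff order_trans)
    also have "\<dots> = (q * sqrt CARD('n) * sqrt (norm E))\<^sup>2"
      by (simp add: power_mult_distrib) (simp add: power2_eq_square)
    finally have nQX: "norm (Q ** X) \<le> q * sqrt CARD('n) * sqrt (norm E)"
      by (rule power2_le_imp_le) (simp add: q_def)
    have E_sqrt: "norm E \<le> sqrt (norm E)"
      using E(1) by (intro real_le_rsqrt) (simp add: power2_eq_square mult_left_le)
    have V2: "2 *\<^sub>R V = Q ** X + (P ** E ** S + Q ** E ** S ** M ** S) ** X"
      by (simp add: V_def L_def matrix_mult_linear_simps add.assoc)
    have "norm V \<le> norm (2 *\<^sub>R V)" by simp
    also have "\<dots> \<le> norm (Q ** X) + norm (P ** E ** S + Q ** E ** S ** M ** S) * norm X"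
      unfolding V2 using norm_triangle_ineq norm_matrix_mult by (meson add_left_mono order_trans)
    also have "\<dots> \<le> q * sqrt CARD('n) * sqrt (norm E)
        + (norm P * norm E * \<sigma> + (q * norm E * \<sigma>) * norm M * \<sigma>) * B"
      using \<sigma> by (intro add_mono nQX mult_mono X order_trans[OF norm_triangle_ineq] nPES nQESMS)
        (simp_all add: q_def)
    also have "\<dots> = q * sqrt CARD('n) * sqrt (norm E)
        + ((norm P * \<sigma> + q * \<sigma> * norm M * \<sigma>) * B) * norm E"
      by (simp add: algebra_simps)
    also have "\<dots> \<le> C1 * sqrt (norm E)"
    proof -
      have "0 \<le> B" using X norm_ge_zero order_trans by blast
      then have "0 \<le> (norm P * \<sigma> + q * \<sigma> * norm M * \<sigma>) * B"
        by (simp add: \<sigma> q_def)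
      from mult_left_mono[OF E_sqrt this] show ?thesis
        by (simp add: C1_def distrib_right)
    qed
    finally have "norm V \<le> max C1 C2 * sqrt (norm E)"
      by (rule order_trans) (simp add: mult_right_mono)
    moreover have "norm (X ** transpose V + V ** transpose X - E) \<le> max C1 C2 * (norm E)\<^sup>2"
      by (rule order_trans[OF nres]) (simp add: mult_right_mono)
    ultimately show ?thesis unfolding E_def by blast
  qed
  moreover have "\<epsilon>' > 0" using \<epsilon> p(1) by (simp add: \<epsilon>'_def)
  ultimately show ?thesis by blast
qed

section \<open>Bounded seminorms\<close>

locale bounded_seminorm =
  fixes p :: "'a::real_normed_vector \<Rightarrow> real"
  assumes triangle: "p (A + B) \<le> p A + p B"
    and absolutely_homogeneous: "p (c *\<^sub>R A) = \<bar>c\<bar> * p A"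
    and bounded: "\<exists>K. \<forall>A. p A \<le> K * norm A"
begin

lemma zero: "p 0 = 0"
  using absolutely_homogeneous[of 0 0] by simp

lemma minus: "p (- A) = p A"
  using absolutely_homogeneous[of "-1" A] by simp

lemma nonneg: "0 \<le> p A"
  using triangle[of A "- A"] by (simp add: zero minus)

lemma pos_bounded: obtains K where "K > 0" "\<And>A. p A \<le> K * norm A"
proof -
  obtain K where K: "\<And>A. p A \<le> K * norm A" using bounded by blast
  have "p A \<le> (\<bar>K\<bar> + 1) * norm A" for A
    by (rule order_trans[OF K]) (intro mult_right_mono; simp)
  then show ?thesis using that[of "\<bar>K\<bar> + 1"] by simp
qed

lemma triangle_diff: "\<bar>p A - p B\<bar> \<le> p (A - B)"
  using triangle[of "A - B" B] triangle[of "B - A" A] minus[of "A - B"] by simp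

lemma continuous_on_compose:
  assumes "continuous_on S g"
  shows "continuous_on S (\<lambda>x. p (g x))"
proof -
  obtain K where K: "K > 0" "\<And>A. p A \<le> K * norm A" using pos_bounded by blast
  have "K-lipschitz_on UNIV p"
    using K order_trans[OF triangle_diff] by (intro lipschitz_onI) (auto simp: dist_norm)
  then have "continuous_on UNIV p" by (rule lipschitz_on_continuous_on)
  then show ?thesis using assms continuous_on_compose2 by blast
qed

end

lemma bounded_seminorm_norm_linear:
  assumes "bounded_linear L"
  shows "bounded_seminorm (\<lambda>A. norm (L A))"
proof
  interpret bounded_linear L by fact
  show "norm (L (A + B)) \<le> norm (L A) + norm (L B)" for A B
    by (simp add: add norm_triangle_ineq)
  show "norm (L (c *\<^sub>R A)) = \<bar>c\<bar> * norm (L A)" for c A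
    by (simp add: scaleR)
  show "\<exists>K. \<forall>A. norm (L A) \<le> K * norm A"
    using bounded by (metis mult.commute)
qed

lemma bounded_seminorm_l1_norm: "bounded_seminorm (l1_norm :: real^'n^'m \<Rightarrow> real)"
proof
  fix A B :: "real^'n^'m" and c :: real
  show "l1_norm (A + B) \<le> l1_norm A + l1_norm B"
    by (simp add: l1_norm_def sum_mono flip: sum.distrib)
  show "l1_norm (c *\<^sub>R A) = \<bar>c\<bar> * l1_norm A"
    by (simp add: l1_norm_def abs_mult sum_distrib_left)
  have "\<bar>A $ i $ j\<bar> \<le> norm A" for A :: "real^'n^'m" and i j
    using component_le_norm_cart[of "A $ i" j] Finite_Cartesian_Product.norm_nth_le[of A i] by simp
  then have "l1_norm A \<le> (\<Sum>i\<in>(UNIV::'m set). \<Sum>j\<in>(UNIV::'n set). norm A)" for A :: "real^'n^'m"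
    unfolding l1_norm_def by (intro sum_mono)
  then show "\<exists>K. \<forall>A::real^'n^'m. l1_norm A \<le> K * norm A"
    by (intro exI[of _ "real CARD('m) * real CARD('n)"]) (simp add: mult.assoc)
qed

lemma norm_le_l1_norm: "norm A \<le> l1_norm A"
proof -
  have "norm A \<le> (\<Sum>i\<in>UNIV. norm (A $ i))"
    unfolding norm_vec_def[of A] by (rule L2_set_le_sum) simp
  also have "\<dots> \<le> l1_norm A"
    unfolding l1_norm_def by (intro sum_mono norm_le_l1_cart)
  finally show ?thesis .
qed

section \<open>Kurdyka-Lojasiewicz exponents for seminorms of a factorization error\<close>

lemma abs_power_diff_le:
  fixes a b :: real
  assumes "0 \<le> a" "a \<le> B" "0 \<le> b" "b \<le> B"
  shows "\<bar>a ^ k - b ^ k\<bar> \<le> k * B ^ (k - 1) * \<bar>a - b\<bar>"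
proof (induction k)
  case (Suc k)
  have "a ^ Suc k - b ^ Suc k = a * (a ^ k - b ^ k) + b ^ k * (a - b)"
    by (simp add: algebra_simps)
  then have "\<bar>a ^ Suc k - b ^ Suc k\<bar> \<le> a * \<bar>a ^ k - b ^ k\<bar> + b ^ k * \<bar>a - b\<bar>"
    using assms abs_triangle_ineq[of "a * (a ^ k - b ^ k)" "b ^ k * (a - b)"] by (simp add: abs_mult)
  also have "\<dots> \<le> B * (k * B ^ (k - 1) * \<bar>a - b\<bar>) + B ^ k * \<bar>a - b\<bar>"
    using assms Suc by (intro add_mono mult_mono power_mono) auto
  also have "\<dots> = Suc k * B ^ k * \<bar>a - b\<bar>"
    by (cases k) (simp_all add: algebra_simps)
  finally show ?case by simp
qed simp

lemma norm_gram_diff_le: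
  fixes X Y :: "real^'r^'n"
  shows "norm (X ** transpose X - Y ** transpose Y) \<le> (norm X + norm Y) * norm (X - Y)"
proof -
  have "X ** transpose X - Y ** transpose Y = X ** transpose (X - Y) + (X - Y) ** transpose Y"
    by (simp add: transpose_linear_simps matrix_mult_linear_simps)
  then have "norm (X ** transpose X - Y ** transpose Y)
      \<le> norm (X ** transpose (X - Y)) + norm ((X - Y) ** transpose Y)"
    by (simp add: norm_triangle_ineq)
  also have "\<dots> \<le> norm X * norm (X - Y) + norm (X - Y) * norm Y"
    using norm_matrix_mult[of X "transpose (X - Y)"] norm_matrix_mult[of "X - Y" "transpose Y"]
    by (simp add: norm_transpose)
  finally show ?thesis by (simp add: algebra_simps)
qed

lemma locally_lipschitz_seminorm_gram_power:
  fixes p :: "real^'n^'n \<Rightarrow> real" and M :: "real^'n^'n"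
  assumes "bounded_seminorm p"
  shows "locally_lipschitz (\<lambda>X::real^'r^'n. c + p (X ** transpose X - M) ^ k)"
  unfolding locally_lipschitz_def
proof
  fix X0 :: "real^'r^'n"
  interpret bounded_seminorm p by fact
  obtain K where K: "K > 0" "\<And>A. p A \<le> K * norm A" using pos_bounded by blast
  define R where "R = norm X0 + 1"
  define B where "B = K * (R * R + norm M)"
  have R: "R > 0" by (simp add: R_def add_nonneg_pos)
  have B: "B \<ge> 0" using K R by (simp add: B_def)
  have X: "norm X \<le> R" if "X \<in> ball X0 1" for X
    using that norm_triangle_ineq2[of X X0] by (simp add: R_def dist_norm norm_minus_commute)
  have pB: "p (X ** transpose X - M) \<le> B" if "X \<in> ball X0 1" for X
  proof -
    have "norm (X ** transpose X - M) \<le> norm X * norm X + norm M"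
      using norm_triangle_ineq4[of "X ** transpose X" M] norm_matrix_mult[of X "transpose X"]
      by (simp add: norm_transpose)
    also have "\<dots> \<le> R * R + norm M"
      using X[OF that] R by (intro add_right_mono mult_mono) auto
    finally show ?thesis
      unfolding B_def using K order_trans mult_left_mono by (metis less_imp_le)
  qed
  have "(k * B ^ (k - 1) * (K * (2 * R)))-lipschitz_on (ball X0 1)
      (\<lambda>X::real^'r^'n. c + p (X ** transpose X - M) ^ k)"
  proof (rule lipschitz_onI)
    fix X Y :: "real^'r^'n" assume XY: "X \<in> ball X0 1" "Y \<in> ball X0 1"
    let ?a = "p (X ** transpose X - M)" and ?b = "p (Y ** transpose Y - M)"
    have "\<bar>?a - ?b\<bar> \<le> p (X ** transpose X - Y ** transpose Y)"
      using triangle_diff[of "X ** transpose X - M" "Y ** transpose Y - M"] by simp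
    also have "\<dots> \<le> K * ((norm X + norm Y) * norm (X - Y))"
      using K norm_gram_diff_le[of X Y] by (meson less_imp_le mult_left_mono order_trans)
    also have "\<dots> \<le> K * ((2 * R) * norm (X - Y))"
      using X[OF XY(1)] X[OF XY(2)] K(1) by (intro mult_left_mono mult_right_mono) auto
    finally have ab: "\<bar>?a - ?b\<bar> \<le> K * (2 * R) * norm (X - Y)" by simp
    have "\<bar>?a ^ k - ?b ^ k\<bar> \<le> k * B ^ (k - 1) * \<bar>?a - ?b\<bar>"
      using XY by (intro abs_power_diff_le pB nonneg)
    also have "\<dots> \<le> k * B ^ (k - 1) * (K * (2 * R) * norm (X - Y))"
      using ab B by (intro mult_left_mono) auto
    finally show "dist (c + ?a ^ k) (c + ?b ^ k) \<le> k * B ^ (k - 1) * (K * (2 * R)) * dist X Y"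
      by (simp add: dist_norm mult.assoc)
  qed (use B K R in simp)
  then show "\<exists>\<rho>>0. \<exists>L. L-lipschitz_on (ball X0 \<rho>) (\<lambda>X::real^'r^'n. c + p (X ** transpose X - M) ^ k)"
    using zero_less_one by blast
qed

text \<open>
  The direction \<open>V\<close> is the same at all points \<open>y\<close>, so the condition on \<open>v\<close> describes a closed half-space,
  which is stable under both the limits and the convex hull in the definition of the subdifferential.
\<close>

lemma clarke_subdifferential_inner_ge:
  fixes f \<beta> :: "'a::euclidean_space \<Rightarrow> real"
  assumes grad: "\<And>y d. GDERIV f y :> d \<Longrightarrow> \<beta> y \<le> V \<bullet> d"
    and cont: "isCont \<beta> x"
    and v: "v \<in> clarke_subdifferential f x"
  shows "\<beta> x \<le> V \<bullet> v"
proof -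
  have "clarke_subdifferential f x \<subseteq> {v. \<beta> x \<le> V \<bullet> v}"
    unfolding clarke_subdifferential_def
  proof (rule hull_minimal)
    show "{v. \<exists>y d. (\<forall>k::nat. GDERIV f (y k) :> d k) \<and> y \<longlonglongrightarrow> x \<and> d \<longlonglongrightarrow> v}
        \<subseteq> {v. \<beta> x \<le> V \<bullet> v}"
    proof safe
      fix v y d
      assume *: "\<forall>k::nat. GDERIV f (y k) :> d k" "y \<longlonglongrightarrow> x" "d \<longlonglongrightarrow> v"
      have "(\<lambda>k. \<beta> (y k)) \<longlonglongrightarrow> \<beta> x" using cont *(2) by (rule isCont_tendsto_compose)
      moreover have "(\<lambda>k. V \<bullet> d k) \<longlonglongrightarrow> V \<bullet> v" using *(3) by (intro tendsto_intros)
      ultimately show "\<beta> x \<le> V \<bullet> v"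
        by (rule LIMSEQ_le) (use grad *(1) in blast)
    qed
    show "convex {v. \<beta> x \<le> V \<bullet> v}" by (rule convex_halfspace_ge)
  qed
  then show ?thesis using v by blast
qed

text \<open>
  Moving from \<open>Y\<close> to \<open>Y - t V\<close> replaces \<open>E\<close> by \<open>(1 - t) E + t (E - D) + t\<^sup>2 V V\<^sup>T\<close>, where
  \<open>D = Y V\<^sup>T + V Y\<^sup>T\<close>. The triangle inequality bounds the function by a polynomial in \<open>t\<close> that agrees with it at
  \<open>t = 0\<close>, so that the derivatives at \<open>0\<close> are ordered. Here \<open>V\<close> may be arbitrary: it will be adapted to a
  limit point of \<open>Y\<close> and not to \<open>Y\<close> itself.
\<close>

lemma gradient_seminorm_gram_power_ge:
  fixes p :: "real^'n^'n \<Rightarrow> real" and M :: "real^'n^'n" and Y V :: "real^'r^'n"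
  assumes "bounded_seminorm p"
    and d: "GDERIV (\<lambda>X. c + p (X ** transpose X - M) ^ k) Y :> d"
  shows "k * p (Y ** transpose Y - M) ^ (k - 1) * (p (Y ** transpose Y - M)
      - p (Y ** transpose Y - M - (Y ** transpose V + V ** transpose Y))) \<le> V \<bullet> d"
proof -
  interpret bounded_seminorm p by fact
  define E where "E = Y ** transpose Y - M"
  define D where "D = Y ** transpose V + V ** transpose Y"
  define W where "W = V ** transpose V"
  define \<psi> where "\<psi> t = c + p ((Y - t *\<^sub>R V) ** transpose (Y - t *\<^sub>R V) - M) ^ k" for t :: real
  define u where "u t = c + ((1 - t) * p E + t * p (E - D) + t\<^sup>2 * p W) ^ k" for t :: real
  have expand: "(Y - t *\<^sub>R V) ** transpose (Y - t *\<^sub>R V) - M = E - t *\<^sub>R D + t\<^sup>2 *\<^sub>R W" for t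
    by (simp add: E_def D_def W_def transpose_linear_simps matrix_mult_linear_simps algebra_simps power2_eq_square)
  have le: "\<psi> t \<le> u t" if "0 < t" "t < 1" for t
  proof -
    have "E - t *\<^sub>R D + t\<^sup>2 *\<^sub>R W = (1 - t) *\<^sub>R E + t *\<^sub>R (E - D) + t\<^sup>2 *\<^sub>R W"
      by (simp add: algebra_simps)
    also have "p \<dots> \<le> p ((1 - t) *\<^sub>R E) + p (t *\<^sub>R (E - D)) + p (t\<^sup>2 *\<^sub>R W)"
      by (meson add_right_mono order_trans triangle)
    also have "\<dots> = (1 - t) * p E + t * p (E - D) + t\<^sup>2 * p W"
      using that by (simp add: absolutely_homogeneous)
    finally show ?thesis unfolding \<psi>_def u_def expand
      by (intro add_left_mono power_mono nonneg)
  qed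
  have "((\<lambda>t. Y - t *\<^sub>R V) has_derivative (\<lambda>t. - (t *\<^sub>R V))) (at 0)"
    by (auto intro!: derivative_eq_intros)
  moreover have "((\<lambda>X. c + p (X ** transpose X - M) ^ k) has_derivative (\<lambda>h. h \<bullet> d)) (at (Y - 0 *\<^sub>R V))"
    using d by (simp add: gderiv_def)
  ultimately have "(\<psi> has_derivative (\<lambda>t. (- (t *\<^sub>R V)) \<bullet> d)) (at 0)"
    unfolding \<psi>_def by (rule has_derivative_compose)
  then have "(\<psi> has_real_derivative - (V \<bullet> d)) (at 0)"
    by (rule has_derivative_imp_has_field_derivative) simp
  moreover have "(u has_real_derivative k * p E ^ (k - 1) * (p (E - D) - p E)) (at 0)"
    unfolding u_def by (rule derivative_eq_intros refl | simp)+
  ultimately have diff: "((\<lambda>t. u t - \<psi> t) has_real_derivative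
      k * p E ^ (k - 1) * (p (E - D) - p E) - - (V \<bullet> d)) (at 0)"
    by (rule DERIV_diff[rotated])
  have "0 \<le> k * p E ^ (k - 1) * (p (E - D) - p E) - - (V \<bullet> d)"
  proof (rule ccontr)
    assume "\<not> ?thesis"
    then obtain \<epsilon> where \<epsilon>: "\<epsilon> > 0" "\<And>h. 0 < h \<Longrightarrow> h < \<epsilon> \<Longrightarrow> u 0 - \<psi> 0 > u (0 + h) - \<psi> (0 + h)"
      using DERIV_neg_dec_right[OF diff] by fastforce
    define h where "h = min \<epsilon> 1 / 2"
    have h: "0 < h" "h < \<epsilon>" "h < 1" using \<epsilon>(1) by (auto simp: h_def)
    have "u 0 = \<psi> 0" by (simp add: u_def \<psi>_def E_def)
    then show False using \<epsilon>(2)[OF h(1,2)] le[OF h(1,3)] by simp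
  qed
  then show ?thesis by (simp add: E_def D_def algebra_simps)
qed

text \<open>
  For \<open>V\<close> as in \<open>descent_direction\<close> at \<open>X\<close>, the error term \<open>p(E - D)\<close> is of order \<open>|E|\<^sup>2\<close>, hence at most
  \<open>p(E)/2\<close> near \<open>Xbar\<close>. Thus a subgradient \<open>v\<close> at \<open>X\<close> satisfies
  \<open>p(E)^k / 2 \<le> V \<bullet> v \<le> |V| |v|\<close>, while \<open>|V|\<close> is at most of order \<open>p(E)\<^sup>1\<^sup>/\<^sup>2\<close>. Coercivity is
  asked of \<open>p\<close> on the differences \<open>X X\<^sup>T - M\<close> alone: their rank is bounded, so that a restricted isometry
  property can supply it.
\<close>

theorem KL_exponent_seminorm_gram_power:
  fixes p :: "real^'n^'n \<Rightarrow> real" and M :: "real^'n^'n" and Xbar :: "real^'r^'n"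
  assumes p: "bounded_seminorm p"
    and M: "transpose M = M" and Xbar: "Xbar ** transpose Xbar = M"
    and k: "k \<ge> 1" and m: "m > 0"
    and coercive: "\<And>X::real^'r^'n. m * norm (X ** transpose X - M) \<le> p (X ** transpose X - M)"
  shows "has_KL_exponent (\<lambda>X. c + p (X ** transpose X - M) ^ k) (1 - 1 / (2 * real k)) Xbar"
proof -
  interpret bounded_seminorm p by fact
  define E where "E X = X ** transpose X - M" for X :: "real^'r^'n"
  let ?f = "\<lambda>X. c + p (X ** transpose X - M) ^ k"
  obtain K where K: "K > 0" "\<And>A. p A \<le> K * norm A" using pos_bounded by blast
  obtain \<epsilon> C0 where \<epsilon>: "\<epsilon> > 0" and C0: "\<And>X::real^'r^'n. norm X \<le> norm Xbar + 1 \<Longrightarrow> norm (E X) \<le> \<epsilon> \<Longrightarrow>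
      \<exists>V. norm V \<le> C0 * sqrt (norm (E X)) \<and>
          norm (X ** transpose V + V ** transpose X - E X) \<le> C0 * (norm (E X))\<^sup>2"
    using descent_direction[OF M, of "norm Xbar + 1"] unfolding E_def by metis
  define C where "C = \<bar>C0\<bar> + 1"
  have C: "C > 0" by (simp add: C_def)
  \<comment> \<open>For \<open>|E| \<le> m/(2KC)\<close> the seminorm of the second-order error is at most \<open>m |E| / 2 \<le> p(E) / 2\<close>.\<close>
  define \<epsilon>' where "\<epsilon>' = min \<epsilon> (m / (2 * K * C))"
  have \<epsilon>': "\<epsilon>' > 0" using \<epsilon> m K(1) C by (simp add: \<epsilon>'_def)
  have contE: "continuous_on UNIV E"
    unfolding E_def
    by (intro continuous_intros bounded_bilinear.continuous_on[OF bounded_bilinear_matrix_mult]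
        bounded_linear.continuous_on[OF bounded_linear_transpose])
  obtain \<rho>0 where \<rho>0: "\<rho>0 > 0" "\<And>X. dist X Xbar < \<rho>0 \<Longrightarrow> norm (E X) < \<epsilon>'"
  proof -
    have "isCont E Xbar" using contE by (simp add: continuous_on_eq_continuous_at)
    then obtain \<rho> where "\<rho> > 0" "\<And>X. dist X Xbar < \<rho> \<Longrightarrow> dist (E X) (E Xbar) < \<epsilon>'"
      using \<epsilon>' unfolding continuous_at_eps_delta by blast
    moreover have "E Xbar = 0" by (simp add: E_def Xbar)
    ultimately show ?thesis using that by simp
  qed
  have main: "sqrt m / (2 * C) * (p (E X) ^ k) powr (1 - 1 / (2 * real k)) \<le> norm v"
    if X: "X \<in> ball Xbar (min \<rho>0 1)" and pos: "0 < p (E X) ^ k"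
      and v: "v \<in> clarke_subdifferential ?f X" for X v
  proof -
    have "norm X \<le> norm Xbar + 1"
      using X norm_triangle_ineq2[of X Xbar] by (simp add: dist_norm norm_minus_commute)
    moreover have small: "norm (E X) < \<epsilon>'" using X \<rho>0(2) by (simp add: dist_commute)
    ultimately obtain V where V0: "norm V \<le> C0 * sqrt (norm (E X))"
      "norm (X ** transpose V + V ** transpose X - E X) \<le> C0 * (norm (E X))\<^sup>2"
      using C0[of X] by (auto simp: \<epsilon>'_def)
    have "C0 \<le> C" by (simp add: C_def)
    then have V: "norm V \<le> C * sqrt (norm (E X))"
      "norm (X ** transpose V + V ** transpose X - E X) \<le> C * (norm (E X))\<^sup>2"
      using V0 by (meson mult_right_mono order_trans norm_ge_zero real_sqrt_ge_zero zero_le_power2)+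
    define e where "e = p (E X)"
    have e: "e > 0" using pos k nonneg[of "E X"] by (cases "p (E X) = 0") (simp_all add: e_def power_0_left)
    have me: "m * norm (E X) \<le> e" using coercive[of X] by (simp add: e_def E_def)
    have "p (E X - (X ** transpose V + V ** transpose X)) \<le> K * (C * (norm (E X))\<^sup>2)"
    proof (rule order_trans[OF K(2)], rule mult_left_mono)
      show "norm (E X - (X ** transpose V + V ** transpose X)) \<le> C * (norm (E X))\<^sup>2"
        using V(2) by (simp only: norm_minus_commute)
    qed (use K(1) in simp)
    also have "\<dots> = (K * C * norm (E X)) * norm (E X)" by (simp add: power2_eq_square)
    also have "\<dots> \<le> (m / 2) * norm (E X)"
    proof (rule mult_right_mono)
      have "norm (E X) \<le> m / (2 * K * C)" using small by (simp add: \<epsilon>'_def)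
      then show "K * C * norm (E X) \<le> m / 2" using K(1) C by (simp add: field_simps)
    qed simp
    finally have half: "e / 2 \<le> e - p (E X - (X ** transpose V + V ** transpose X))"
      using me by simp
    let ?\<beta> = "\<lambda>Y. k * p (E Y) ^ (k - 1) * (p (E Y) - p (E Y - (Y ** transpose V + V ** transpose Y)))"
    have "isCont ?\<beta> X"
    proof -
      have "continuous_on UNIV ?\<beta>"
        by (intro continuous_intros continuous_on_compose contE
          bounded_bilinear.continuous_on[OF bounded_bilinear_matrix_mult]
          bounded_linear.continuous_on[OF bounded_linear_transpose])
      then show ?thesis by (simp add: continuous_on_eq_continuous_at)
    qed
    then have "?\<beta> X \<le> V \<bullet> v"
      using clarke_subdifferential_inner_ge[OF _ _ v, of ?\<beta> V]
        gradient_seminorm_gram_power_ge[OF p, of c M k _ _ V]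
      unfolding E_def by blast
    also have "\<dots> \<le> norm V * norm v" by (rule norm_cauchy_schwarz)
    also have "\<dots> \<le> C * sqrt (norm (E X)) * norm v" using V(1) by (rule mult_right_mono) simp
    also have "\<dots> \<le> C * (sqrt e / sqrt m) * norm v"
    proof -
      have "sqrt (norm (E X)) \<le> sqrt (e / m)"
        using me m by (simp add: field_simps)
      then show ?thesis using C by (intro mult_right_mono mult_left_mono) (auto simp: real_sqrt_divide)
    qed
    finally have upper: "k * e ^ (k - 1) * (e - p (E X - (X ** transpose V + V ** transpose X)))
        \<le> C * (sqrt e / sqrt m) * norm v" by (simp add: e_def)
    have "e ^ k / 2 = e ^ (k - 1) * (e / 2)"
      using k by (simp add: power_eq_if)
    also have "\<dots> \<le> k * e ^ (k - 1) * (e / 2)"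
      using k e by simp
    also have "\<dots> \<le> C * (sqrt e / sqrt m) * norm v"
      by (rule order_trans[OF mult_left_mono[OF half] upper]) (use e in simp)
    finally have bound: "e ^ k / 2 \<le> C * (sqrt e / sqrt m) * norm v" .
    have "(e ^ k) powr (1 - 1 / (2 * real k)) = e powr (real k * (1 - 1 / (2 * real k)))"
      using e by (simp add: powr_powr flip: powr_realpow)
    also have "real k * (1 - 1 / (2 * real k)) = real k - 1 / 2"
      using k by (simp add: field_simps)
    also have "e powr (real k - 1 / 2) = e ^ k / sqrt e"
      using e by (simp add: powr_diff powr_realpow powr_half_sqrt)
    finally have "sqrt m / (2 * C) * (e ^ k) powr (1 - 1 / (2 * real k)) = sqrt m / (2 * C) * (e ^ k / sqrt e)"
      by simp
    also have "\<dots> \<le> norm v"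
      using bound e m C by (simp add: field_simps)
    finally show ?thesis by (simp add: e_def)
  qed
  have "?f Xbar = c" using k by (simp add: Xbar zero)
  then have diff: "?f X - ?f Xbar = p (E X) ^ k" for X by (simp add: E_def)
  have exponent: "0 \<le> 1 - 1 / (2 * real k)" "1 - 1 / (2 * real k) < 1"
    using k by (simp_all add: field_simps)
  show ?thesis
    unfolding has_KL_exponent_def diff
  proof (intro conjI exponent locally_lipschitz_seminorm_gram_power[OF p] exI ballI impI)
    show "0 < min \<rho>0 1" using \<rho>0(1) by simp
    show "(0::real) < 1" by simp
    show "0 < sqrt m / (2 * C)" using m C by simp
    fix X assume "X \<in> ball Xbar (min \<rho>0 1)" "0 < p (E X) ^ k \<and> p (E X) ^ k < 1"
    then show "ereal (sqrt m / (2 * C) * (p (E X) ^ k) powr (1 - 1 / (2 * real k)))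
        \<le> (INF v\<in>clarke_subdifferential ?f X. ereal (norm v))"
      using main by (intro INF_greatest) simp
  qed
qed

section \<open>Gram factorizations of positive semidefinite matrices\<close>

lemma rank_gram_minus_le:
  fixes X :: "real^'r^'n" and M :: "real^'n^'n"
  shows "rank (X ** transpose X - M) \<le> rank M + CARD('r)"
proof -
  let ?S = "range ((*v) (X ** transpose X))" and ?T = "range ((*v) M)"
  have sub: "subspace ?S" "subspace ?T"
    by (metis linear_subspace_image matrix_vector_mul_linear subspace_UNIV)+
  have "range ((*v) (X ** transpose X - M)) \<subseteq> {x + y |x y. x \<in> ?S \<and> y \<in> ?T}"
  proof
    fix z assume "z \<in> range ((*v) (X ** transpose X - M))"
    then obtain w where "z = (X ** transpose X) *v w + M *v (- w)"
      by (auto simp: algebra_simps matrix_vector_mult_diff_rdistrib linear_neg[OF matrix_vector_mul_linear])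
    then show "z \<in> {x + y |x y. x \<in> ?S \<and> y \<in> ?T}" by blast
  qed
  then have "rank (X ** transpose X - M) \<le> dim {x + y |x y. x \<in> ?S \<and> y \<in> ?T}"
    unfolding rank_dim_range by (rule dim_subset)
  also have "\<dots> \<le> dim ?S + dim ?T"
    using dim_sums_Int[OF sub] by simp
  also have "\<dots> \<le> CARD('r) + rank M"
    using rank_mul_le_left[of X "transpose X"] rank_bound[of X]
    by (simp add: rank_dim_range[symmetric])
  finally show ?thesis by simp
qed

text \<open>
  The quadratic form is nonnegative at \<open>x - t M x\<close>, where its value is \<open>- 2 t |M x|\<^sup>2 + O(t\<^sup>2)\<close>;
  this rules out \<open>M x \<noteq> 0\<close>, because small \<open>t > 0\<close> would give a negative value.
\<close>

lemma psd_inner_mult_zero_imp_mult_zero: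
  assumes M: "M \<in> psdmat" and x: "x \<bullet> (M *v x) = 0"
  shows "M *v x = 0"
proof (rule ccontr)
  assume "M *v x \<noteq> 0"
  have sym: "y \<bullet> (M *v z) = z \<bullet> (M *v y)" for y z
    using M unfolding psdmat_def symmat_def
    by (metis (mono_tags, lifting) dot_lmul_matrix inner_commute mem_Collect_eq transpose_matrix_vector)
  define a where "a = (M *v x) \<bullet> (M *v x)"
  define b where "b = (M *v x) \<bullet> (M *v (M *v x))"
  have a: "a > 0" using \<open>M *v x \<noteq> 0\<close> by (simp add: a_def)
  have b: "b \<ge> 0" using M by (simp add: b_def psdmat_def)
  have "0 \<le> (x - t *\<^sub>R (M *v x)) \<bullet> (M *v (x - t *\<^sub>R (M *v x)))" for t
    using M by (simp add: psdmat_def)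
  also have "(x - t *\<^sub>R (M *v x)) \<bullet> (M *v (x - t *\<^sub>R (M *v x))) = t * (t * b - 2 * a)" for t
    using sym[of x "M *v x"] x
    by (simp add: a_def b_def algebra_simps matrix_vector_mult_diff_distrib matrix_vector_mult_scaleR
        inner_diff_left inner_diff_right)
  finally have "0 \<le> a / (b + 1) * (a / (b + 1) * b - 2 * a)" .
  moreover have "a / (b + 1) * b \<le> a" using a b by (simp add: field_simps)
  then have "a / (b + 1) * b - 2 * a < 0" using a by simp
  moreover have "a / (b + 1) > 0" using a b by simp
  ultimately show False using mult_pos_neg[of "a / (b + 1)" "a / (b + 1) * b - 2 * a"] by linarith
qed

text \<open>
  One step of a Cholesky decomposition without coordinates: for \<open>a = x \<bullet> M x > 0\<close>, subtract \<open>u u\<^sup>T\<close> with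
  \<open>u = M x / a\<^sup>1\<^sup>/\<^sup>2\<close>. The result stays positive semidefinite because its form at \<open>y\<close> is that of \<open>M\<close> at
  \<open>y - t x\<close> for the minimizing \<open>t\<close>. It annihilates \<open>x\<close>, so \<open>M x\<close> is lost from its range.
\<close>

lemma psd_rank_one_reduction:
  fixes M :: "real^'n^'n"
  assumes M: "M \<in> psdmat" and nz: "M \<noteq> 0"
  shows "\<exists>u. (\<chi> i j. M $ i $ j - u $ i * u $ j) \<in> psdmat
    \<and> rank (\<chi> i j. M $ i $ j - u $ i * u $ j) < rank M"
proof -
  have symM: "transpose M = M" and pos: "\<And>x. 0 \<le> x \<bullet> (M *v x)"
    using M by (auto simp: psdmat_def symmat_def)
  have sym: "y \<bullet> (M *v z) = z \<bullet> (M *v y)" for y z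
    using symM by (metis dot_lmul_matrix inner_commute transpose_matrix_vector)
  obtain x where "M *v x \<noteq> 0" using nz by (metis matrix_eq matrix_vector_mult_0)
  then have x: "x \<bullet> (M *v x) > 0"
    using psd_inner_mult_zero_imp_mult_zero[OF M, of x] pos[of x] by fastforce
  define a where "a = x \<bullet> (M *v x)"
  define u where "u = (1 / sqrt a) *\<^sub>R (M *v x)"
  define N :: "real^'n^'n" where "N = (\<chi> i j. M $ i $ j - u $ i * u $ j)"
  have a: "a > 0" using x by (simp add: a_def)
  have Nv: "N *v y = M *v y - (u \<bullet> y) *\<^sub>R u" for y
    by (simp add: N_def vec_eq_iff matrix_vector_mult_def inner_vec_def algebra_simps
        sum_subtractf sum_distrib_left)
  have uy: "u \<bullet> y = (x \<bullet> (M *v y)) / sqrt a" for y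
    using sym[of x y] by (simp add: u_def inner_commute)
  have symN: "transpose N = N"
    using symM by (simp add: N_def transpose_def vec_eq_iff mult.commute)
  have "0 \<le> y \<bullet> (N *v y)" for y
  proof -
    define t where "t = (x \<bullet> (M *v y)) / a"
    have "0 \<le> (y - t *\<^sub>R x) \<bullet> (M *v (y - t *\<^sub>R x))" by (rule pos)
    also have "\<dots> = y \<bullet> (M *v y) - 2 * t * (x \<bullet> (M *v y)) + t * t * a"
      using sym[of y x]
      by (simp add: a_def algebra_simps matrix_vector_mult_diff_distrib matrix_vector_mult_scaleR)
    also have "\<dots> = y \<bullet> (M *v y) - (x \<bullet> (M *v y))\<^sup>2 / a"
      using a by (simp add: t_def field_simps power2_eq_square)
    also have "\<dots> = y \<bullet> (N *v y)"
      using a uy[of y] by (simp add: Nv inner_diff_right inner_commute[of y u] power2_eq_square)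
    finally show ?thesis .
  qed
  then have psd: "N \<in> psdmat" using symN by (simp add: psdmat_def symmat_def)
  have Nx: "N *v x = 0"
    using a uy[of x] by (simp add: Nv a_def[symmetric] u_def)
  have "range ((*v) N) \<subset> range ((*v) M)"
  proof
    have "N *v y = M *v (y - ((u \<bullet> y) / sqrt a) *\<^sub>R x)" for y
      by (simp add: Nv u_def matrix_vector_mult_diff_distrib matrix_vector_mult_scaleR)
    then show "range ((*v) N) \<subseteq> range ((*v) M)" by auto
    have "M *v x \<notin> range ((*v) N)"
    proof
      assume "M *v x \<in> range ((*v) N)"
      then obtain y where "M *v x = N *v y" by auto
      then have "a = x \<bullet> (N *v y)" by (simp add: a_def)
      also have "\<dots> = y \<bullet> (N *v x)"
        using symN by (metis dot_lmul_matrix inner_commute transpose_matrix_vector)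
      finally show False using a Nx by simp
    qed
    then show "range ((*v) N) \<noteq> range ((*v) M)" by blast
  qed
  then have "rank N < rank M"
    unfolding rank_dim_range
    by (intro dim_psubset) (metis linear_subspace_image matrix_vector_mul_linear span_eq_iff subspace_UNIV)
  with psd show ?thesis unfolding N_def by blast
qed

lemma psd_sum_outer_products:
  fixes M :: "real^'n^'n"
  assumes "finite I" "M \<in> psdmat" "rank M \<le> card I"
  shows "\<exists>u::'i \<Rightarrow> real^'n. \<forall>i j. M $ i $ j = (\<Sum>k\<in>I. u k $ i * u k $ j)"
  using assms
proof (induction I arbitrary: M rule: finite_induct)
  case empty
  then show ?case by (simp add: rank_eq_0)
next
  case (insert k I)
  show ?case
  proof (cases "M = 0")
    case True
    then show ?thesis by (intro exI[of _ "\<lambda>_. 0"]) simp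
  next
    case False
    then obtain v where v: "(\<chi> i j. M $ i $ j - v $ i * v $ j) \<in> psdmat"
      "rank (\<chi> i j. M $ i $ j - v $ i * v $ j) < rank M"
      using psd_rank_one_reduction insert.prems by blast
    then obtain u :: "'i \<Rightarrow> real^'n" where u: "\<And>i j. M $ i $ j - v $ i * v $ j = (\<Sum>l\<in>I. u l $ i * u l $ j)"
      using insert.IH[OF v(1)] insert.prems insert.hyps by auto
    have "M $ i $ j = (\<Sum>l\<in>insert k I. (u(k := v)) l $ i * (u(k := v)) l $ j)" for i j
    proof -
      have "(\<Sum>l\<in>I. (u(k := v)) l $ i * (u(k := v)) l $ j) = (\<Sum>l\<in>I. u l $ i * u l $ j)"
        using insert.hyps by (intro sum.cong) auto
      then show ?thesis using u[of i j] insert.hyps by simp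
    qed
    then show ?thesis by blast
  qed
qed

lemma psd_gram_factorization:
  fixes M :: "real^'n^'n"
  assumes "M \<in> psdmat" "rank M \<le> CARD('r)"
  shows "\<exists>Y::real^'r^'n. Y ** transpose Y = M"
proof -
  obtain u :: "'r \<Rightarrow> real^'n" where "\<And>i j. M $ i $ j = (\<Sum>k\<in>UNIV. u k $ i * u k $ j)"
    using psd_sum_outer_products[of "UNIV :: 'r set" M] assms by auto
  then have "(\<chi> i k. u k $ i) ** transpose (\<chi> i k. u k $ i) = M"
    by (simp add: vec_eq_iff matrix_matrix_mult_def transpose_def)
  then show ?thesis by blast
qed

section \<open>Least squares on symmetric matrices\<close>

lemma symmat_closed:
  "0 \<in> symmat" "A \<in> symmat \<Longrightarrow> B \<in> symmat \<Longrightarrow> A + B \<in> symmat"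
  "A \<in> symmat \<Longrightarrow> B \<in> symmat \<Longrightarrow> A - B \<in> symmat"
  "A \<in> symmat \<Longrightarrow> c *\<^sub>R A \<in> symmat" "X ** transpose X \<in> symmat"
  by (simp_all add: symmat_def transpose_linear_simps matrix_transpose_mul)

text \<open>
  Composition with the symmetrization \<open>A \<mapsto> (A + A\<^sup>T)/2\<close>.
\<close>

lemma linear_on_symmat_extends:
  fixes \<A> :: "real^'n^'n \<Rightarrow> 'b::real_normed_vector"
  assumes "linear_on_symmat \<A>"
  shows "\<exists>L. bounded_linear L \<and> (\<forall>A\<in>symmat. L A = \<A> A)"
proof -
  define sym :: "real^'n^'n \<Rightarrow> real^'n^'n" where "sym A = (1/2) *\<^sub>R (A + transpose A)" for A
  have sym: "sym A \<in> symmat" for A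
    by (simp add: sym_def symmat_def transpose_linear_simps add.commute)
  have "linear (\<lambda>A. \<A> (sym A))"
  proof (rule linearI)
    fix A B :: "real^'n^'n" and c :: real
    have "sym (A + B) = sym A + sym B" "sym (c *\<^sub>R A) = c *\<^sub>R sym A"
      by (simp_all add: sym_def transpose_linear_simps scaleR_add_right)
    then show "\<A> (sym (A + B)) = \<A> (sym A) + \<A> (sym B)" "\<A> (sym (c *\<^sub>R A)) = c *\<^sub>R \<A> (sym A)"
      using assms sym by (simp_all add: linear_on_symmat_def)
  qed
  moreover have "\<A> (sym A) = \<A> A" if "A \<in> symmat" for A
    using that by (simp add: sym_def symmat_def flip: scaleR_2)
  ultimately show ?thesis
    by (intro exI[of _ "\<lambda>A. \<A> (sym A)"]) (simp add: linear_conv_bounded_linear)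
qed

text \<open>
  The second derivative of \<open>|L A - b|\<^sup>2\<close> in the direction \<open>H\<close> is \<open>2 |L H|\<^sup>2\<close> at every point. It suffices to
  identify it at \<open>0\<close>, whose rank meets any bound \<open>w\<close>, by restricting \<open>g\<close> to the line through \<open>0\<close> and \<open>H\<close>.
\<close>

lemma RIP_least_squares_lower_bound:
  fixes L :: "real^'n^'n \<Rightarrow> 'b::real_inner"
  assumes L: "linear L" and g: "\<And>A. A \<in> symmat \<Longrightarrow> g A = (norm (L A - b))\<^sup>2"
    and RIP: "RIP \<delta> w t g" and H: "H \<in> symmat" "rank H \<le> t"
  shows "(1 - \<delta>) * (norm H)\<^sup>2 \<le> 2 * (norm (L H))\<^sup>2"
proof -
  obtain g' g'' where C2: "C2_on_symmat g g' g''"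
    and lower: "\<And>A H. A \<in> symmat \<Longrightarrow> H \<in> symmat \<Longrightarrow> rank A \<le> w \<Longrightarrow> rank H \<le> t \<Longrightarrow>
      (1 - \<delta>) * (norm H)\<^sup>2 \<le> g'' A H H"
    using RIP unfolding RIP_def by blast
  have line: "(\<lambda>s. s *\<^sub>R H) ` UNIV \<subseteq> symmat"
    using H(1) by (auto intro: symmat_closed)
  have lineD: "((\<lambda>s. s *\<^sub>R H) has_derivative (\<lambda>s. s *\<^sub>R H)) (at s)" for s
    by (auto intro!: derivative_eq_intros)
  have g'_line: "g' (s *\<^sub>R H) H = - 2 * (L H \<bullet> b) + 2 * s * (norm (L H))\<^sup>2" for s
  proof -
    have "(g has_derivative blinfun_apply (g' (s *\<^sub>R H))) (at (s *\<^sub>R H) within (\<lambda>s. s *\<^sub>R H) ` UNIV)"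
      using C2 line H(1) unfolding C2_on_symmat_def
      by (meson has_derivative_subset symmat_closed(4))
    from has_derivative_in_compose[OF lineD this]
    have "((\<lambda>s. g (s *\<^sub>R H)) has_real_derivative g' (s *\<^sub>R H) H) (at s)"
      by (rule has_derivative_imp_has_field_derivative) (simp add: blinfun.scaleR_right)
    moreover have "g (s *\<^sub>R H) = (norm b)\<^sup>2 - 2 * s * (L H \<bullet> b) + s\<^sup>2 * (norm (L H))\<^sup>2" for s
      unfolding g[OF symmat_closed(4)[OF H(1)]] power2_norm_eq_inner
      by (simp add: linear_scale[OF L] inner_diff_left inner_diff_right inner_commute[of b "L H"])
        (simp add: power2_eq_square algebra_simps)
    ultimately have "((\<lambda>s. (norm b)\<^sup>2 - 2 * s * (L H \<bullet> b) + s\<^sup>2 * (norm (L H))\<^sup>2)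
        has_real_derivative g' (s *\<^sub>R H) H) (at s)" by simp
    moreover have "((\<lambda>s. (norm b)\<^sup>2 - 2 * s * (L H \<bullet> b) + s\<^sup>2 * (norm (L H))\<^sup>2)
        has_real_derivative (- 2 * (L H \<bullet> b) + 2 * s * (norm (L H))\<^sup>2)) (at s)"
      by (rule derivative_eq_intros refl | simp)+
    ultimately show ?thesis by (rule DERIV_unique)
  qed
  have "(g' has_derivative blinfun_apply (g'' 0)) (at (0 *\<^sub>R H) within (\<lambda>s. s *\<^sub>R H) ` UNIV)"
    using C2 line unfolding C2_on_symmat_def
    by (metis has_derivative_subset scale_zero_left symmat_closed(1))
  from bounded_linear.has_derivative[OF blinfun.bounded_linear_left has_derivative_in_compose[OF lineD this], of H]
  have "((\<lambda>s. g' (s *\<^sub>R H) H) has_real_derivative g'' 0 H H) (at 0)"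
    by (rule has_derivative_imp_has_field_derivative) (simp add: blinfun.scaleR_right blinfun.scaleR_left)
  moreover have "((\<lambda>s. g' (s *\<^sub>R H) H) has_real_derivative 2 * (norm (L H))\<^sup>2) (at 0)"
    unfolding g'_line by (rule derivative_eq_intros refl | simp)+
  ultimately have "g'' 0 H H = 2 * (norm (L H))\<^sup>2" by (rule DERIV_unique)
  then show ?thesis
    using lower[OF symmat_closed(1) H(1) _ H(2)] by simp
qed

lemma least_norm_on_line_imp_orthogonal:
  fixes x y :: "'a::real_inner"
  assumes "\<And>t. norm x \<le> norm (x + t *\<^sub>R y)"
  shows "x \<bullet> y = 0"
proof (rule ccontr)
  assume c: "x \<bullet> y \<noteq> 0"
  define t where "t = - (x \<bullet> y) / (y \<bullet> y)"
  have y: "y \<bullet> y > 0" using c by auto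
  have "(norm x)\<^sup>2 \<le> (norm (x + t *\<^sub>R y))\<^sup>2" using assms by (intro power_mono) auto
  also have "\<dots> = (norm x)\<^sup>2 - (x \<bullet> y)\<^sup>2 / (y \<bullet> y)"
  proof -
    have "(norm (x + t *\<^sub>R y))\<^sup>2 = (norm x)\<^sup>2 + 2 * t * (x \<bullet> y) + t * t * (y \<bullet> y)"
      by (simp add: power2_norm_eq_inner inner_add_left inner_add_right inner_commute[of y x]
          algebra_simps)
    also have "\<dots> = (norm x)\<^sup>2 - (x \<bullet> y)\<^sup>2 / (y \<bullet> y)"
      using y unfolding t_def by (simp add: field_simps power2_eq_square[of "x \<bullet> y"])
    finally show ?thesis .
  qed
  finally show False using c y by (simp add: divide_le_0_iff)
qed

text \<open>
  At a minimum \<open>M\<close> the residual \<open>L M - b\<close> is orthogonal to all values of \<open>L\<close> on symmetric matrices, so the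
  cross term vanishes.
\<close>

lemma least_squares_at_minimum:
  fixes L :: "real^'n^'n \<Rightarrow> 'b::real_inner"
  assumes L: "linear L" and g: "\<And>A. A \<in> symmat \<Longrightarrow> g A = (norm (L A - b))\<^sup>2"
    and M: "is_global_min_on g symmat M" and A: "A \<in> symmat"
  shows "g A = g M + (norm (L (A - M)))\<^sup>2"
proof -
  have symM: "M \<in> symmat" and min: "\<And>A. A \<in> symmat \<Longrightarrow> g M \<le> g A"
    using M by (auto simp: is_global_min_on_def)
  have "norm (L M - b) \<le> norm ((L M - b) + t *\<^sub>R L (A - M))" for t
  proof -
    have "M + t *\<^sub>R (A - M) \<in> symmat" using symM A by (intro symmat_closed)
    from min[OF this] g[OF this] g[OF symM]
    have "(norm (L M - b))\<^sup>2 \<le> (norm (L (M + t *\<^sub>R (A - M)) - b))\<^sup>2" by simp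
    also have "L (M + t *\<^sub>R (A - M)) - b = (L M - b) + t *\<^sub>R L (A - M)"
      using L by (simp add: linear_add linear_scale)
    finally show ?thesis by (rule power2_le_imp_le) simp
  qed
  then have "(L M - b) \<bullet> L (A - M) = 0" by (rule least_norm_on_line_imp_orthogonal)
  then have "(norm ((L M - b) + L (A - M)))\<^sup>2 = (norm (L M - b))\<^sup>2 + (norm (L (A - M)))\<^sup>2"
    by (simp add: power2_norm_eq_inner inner_add_left inner_add_right inner_commute)
  moreover have "L A - b = (L M - b) + L (A - M)"
    using L by (simp add: linear_diff)
  ultimately show ?thesis using g[OF A] g[OF symM] by (simp only:)
qed

section \<open>Kurdyka-Lojasiewicz exponents for matrix sensing\<close>

theorem corollary4p30:
  fixes M :: "real^'n^'n" and s :: nat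
    and \<A> :: "real^'n^'n \<Rightarrow> real^'N" and b :: "real^'N" and \<delta> :: real
    and g_sms :: "real^'n^'n \<Rightarrow> real"
    and f1 f_sms :: "real^'r^'n \<Rightarrow> real"
  assumes "M \<in> psdmat" and "rank M = s" and "s \<le> CARD('r)"
    and "linear_on_symmat \<A>"
    and "\<And>A. A \<in> symmat \<Longrightarrow> g_sms A = (norm (\<A> A - b))\<^sup>2"
    and "is_global_min_on g_sms symmat M"
    and "0 < \<delta>" and "\<delta> < 1"
    and "RIP \<delta> (s + CARD('r)) (s + CARD('r)) g_sms"
    and "\<And>X. f1 X = l1_norm (X ** transpose X - M)"
    and "\<And>X. f_sms X = g_sms (X ** transpose X)"
  shows "(\<forall>X. is_global_min_on f1 UNIV X \<longrightarrow> has_KL_exponent f1 (1/2) X) \<and>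
         (\<forall>X. is_global_min_on f_sms UNIV X \<longrightarrow> has_KL_exponent f_sms (3/4) X)"
proof -
  have symM: "M \<in> symmat" "transpose M = M"
    using assms(1) by (auto simp: psdmat_def symmat_def)
  obtain Y :: "real^'r^'n" where Y: "Y ** transpose Y = M"
    using psd_gram_factorization assms(1-3) by blast
  have E: "X ** transpose X - M \<in> symmat" for X :: "real^'r^'n"
    by (intro symmat_closed symM)
  have f1: "f1 = (\<lambda>X. 0 + l1_norm (X ** transpose X - M) ^ 1)"
    by (simp add: assms(10) fun_eq_iff)
  have KL1: "has_KL_exponent f1 (1/2) X" if "is_global_min_on f1 UNIV X" for X
  proof -
    have "l1_norm (X ** transpose X - M) \<le> l1_norm (Y ** transpose Y - M)"
      using that by (simp add: is_global_min_on_def assms(10))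
    also have "\<dots> = 0" by (simp add: Y l1_norm_def)
    finally have "norm (X ** transpose X - M) \<le> 0"
      using norm_le_l1_norm order_trans by blast
    then have "X ** transpose X = M" by simp
    from KL_exponent_seminorm_gram_power[OF bounded_seminorm_l1_norm symM(2) this, of 1 1 0]
    show ?thesis by (simp add: f1 norm_le_l1_norm)
  qed
  obtain L where L: "bounded_linear L" and L\<A>: "\<And>A. A \<in> symmat \<Longrightarrow> L A = \<A> A"
    using linear_on_symmat_extends[OF assms(4)] by blast
  have linL: "linear L" using L by (rule bounded_linear.linear)
  have g: "g_sms A = (norm (L A - b))\<^sup>2" if "A \<in> symmat" for A
    using assms(5) L\<A> that by simp
  define m where "m = sqrt ((1 - \<delta>) / 2)"
  have m: "m > 0" using assms(8) by (simp add: m_def)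
  have coercive: "m * norm (X ** transpose X - M) \<le> norm (L (X ** transpose X - M))" for X :: "real^'r^'n"
  proof -
    have "(1 - \<delta>) * (norm (X ** transpose X - M))\<^sup>2 \<le> 2 * (norm (L (X ** transpose X - M)))\<^sup>2"
      using rank_gram_minus_le[of X M] assms(2)
      by (intro RIP_least_squares_lower_bound[OF linL g assms(9) E]) auto
    then have "(m * norm (X ** transpose X - M))\<^sup>2 \<le> (norm (L (X ** transpose X - M)))\<^sup>2"
      using assms(8) by (simp add: m_def power_mult_distrib field_simps)
    then show ?thesis by (rule power2_le_imp_le) simp
  qed
  have f_sms: "f_sms = (\<lambda>X. g_sms M + norm (L (X ** transpose X - M)) ^ 2)"
    using least_squares_at_minimum[OF linL g assms(6)] symmat_closed(5)
    by (auto simp: assms(11) fun_eq_iff)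
  have KL2: "has_KL_exponent f_sms (3/4) X" if "is_global_min_on f_sms UNIV X" for X
  proof -
    have "f_sms X \<le> f_sms Y" using that by (simp add: is_global_min_on_def)
    then have "norm (L (X ** transpose X - M)) \<le> 0"
      by (simp add: f_sms Y linear_0[OF linL])
    then have "m * norm (X ** transpose X - M) \<le> 0" using coercive[of X] by linarith
    then have "X ** transpose X = M" using m by (simp add: mult_le_0_iff)
    from KL_exponent_seminorm_gram_power[OF bounded_seminorm_norm_linear[OF L] symM(2) this _ m coercive,
        of 2 "g_sms M"]
    show ?thesis by (simp add: f_sms)
  qed
  from KL1 KL2 show ?thesis by blast
qed

end
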